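(* Let $\mathcal{T}\in\mathbb{R}^{I\times J\times K}$, $R\ge1$. Let $\mathbf{M}=\bar{\mathbf{V}}\mathbf{S}\bar{\mathbf{V}}^T$ with $\bar{\mathbf{V}}\in\mathbb{R}^{JK\times JK}$ orthogonal with columns $\bar{\mathbf{v}}_i$ and $\mathbf{S}=\mathrm{diag}(\lambda_1,\dots,\lambda_{JK})$, and let $\bar{\mathbf{V}}_i\in\mathbb{R}^{J\times K}$ be the matricized version of $\bar{\mathbf{v}}_i\in\mathbb{R}^{JK}$. Then for all $\mathbf{B}\in\mathbb{R}^{J\times R}$, $\mathbf{C}\in\mathbb{R}^{K\times R}$, $$\mathfrak{J}_{red}(\mathbf{B},\mathbf{C})=\frac12\sum_{i=1}^{JK}\lambda_i\left(\|\bar{\mathbf{V}}_i-\mathrm{KR}(\mathbf{B},\mathbf{C})\|_F\right)^2,$$ where $$\|\bar{\mathbf{V}}_i-\mathrm{KR}(\mathbf{B},\mathbf{C})\|_F=\inf_{\mathbf{X}\in\mathrm{KR}(\mathbf{B},\mathbf{C})}\|\bar{\mathbf{V}}_i-\mathbf{X}\|_F$$ is the distance of $\bar{\mathbf{V}}_i$ to the linear subspace $\mathrm{KR}(\mathbf{B},\mathbf{C})$.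
   Context: $I,J,K,R$ are positive integers. For $\mathbf{A}\in\mathbb{R}^{I\times R}$, $\mathbf{B}\in\mathbb{R}^{J\times R}$, $\mathbf{C}\in\mathbb{R}^{K\times R}$ with entries $a_{ir},b_{jr},c_{kr}$, put $$\mathfrak{J}(\mathbf{A},\mathbf{B},\mathbf{C})=\tfrac12\sum_{i,j,k}\Big(\mathcal{T}_{ijk}-\sum_{r=1}^R a_{ir}b_{jr}c_{kr}\Big)^2,\qquad \mathfrak{J}_{red}(\mathbf{B},\mathbf{C})=\min_{\mathbf{A}\in\mathbb{R}^{I\times R}}\mathfrak{J}(\mathbf{A},\mathbf{B},\mathbf{C}).$$ $\mathbf{M}\in\mathbb{R}^{JK\times JK}$ is the symmetric matrix whose entry at row $\alpha+(\beta-1)J$ and column $\gamma+(\delta-1)J$ is $\sum_{i=1}^I\mathcal{T}_{i\alpha\beta}\mathcal{T}_{i\gamma\delta}$, for $1\le\alpha,\gamma\le J$, $1\le\beta,\delta\le K$. The matricization of $\mathbf{v}\in\mathbb{R}^{JK}$ is the $J\times K$ matrix whose $(j,k)$ entry is the entry of $\mathbf{v}$ at position $j+(k-1)J$. The Khatri-Rao range is $\mathrm{KR}(\mathbf{B},\mathbf{C})=\{\sum_{r=1}^R\mu_r\,\mathbf{b}_r\circ\mathbf{c}_r\in\mathbb{R}^{J\times K}:\mu_r\in\mathbb{R}\}$, where $\mathbf{b}_r,\mathbf{c}_r$ are the columns of $\mathbf{B},\mathbf{C}$ and $(\mathbf{b}\circ\mathbf{c})_{jk}=b_jc_k$. $\|\cdot\|_F$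 is the Frobenius norm. *)

theory Defs
  imports Complex_Main "Jordan_Normal_Form.Matrix"
begin

text \<open>All indices are 0-based. A tensor of size \<open>I \<times> J \<times> K\<close> is a function of three indices
  of which only the values at \<open>i < I\<close>, \<open>j < J\<close>, \<open>k < K\<close> are ever used.\<close>

type_synonym tensor = "nat \<Rightarrow> nat \<Rightarrow> nat \<Rightarrow> real"

definition cp_objective ::
  "nat \<Rightarrow> nat \<Rightarrow> nat \<Rightarrow> nat \<Rightarrow> tensor \<Rightarrow> real mat \<Rightarrow> real mat \<Rightarrow> real mat \<Rightarrow> real" where
  "cp_objective I J K R T A B C =
     1/2 * (\<Sum>i<I. \<Sum>j<J. \<Sum>k<K.
       (T i j k - (\<Sum>r<R. A $$ (i,r) * B $$ (j,r) * C $$ (k,r)))\<^sup>2)"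

text \<open>The minimum over all \<open>A\<close> is an attained one: \<open>LEAST\<close> is unspecified if there is no
  least value.\<close>

definition cp_reduced_objective ::
  "nat \<Rightarrow> nat \<Rightarrow> nat \<Rightarrow> nat \<Rightarrow> tensor \<Rightarrow> real mat \<Rightarrow> real mat \<Rightarrow> real" where
  "cp_reduced_objective I J K R T B C =
     (LEAST y. \<exists>A \<in> carrier_mat I R. y = cp_objective I J K R T A B C)"

text \<open>The pair \<open>(j,k)\<close> has position \<open>j + k * J\<close>, so that position \<open>p\<close> belongs to the pair
  \<open>(p mod J, p div J)\<close>.\<close>

definition tensor_gram :: "nat \<Rightarrow> nat \<Rightarrow> nat \<Rightarrow> tensor \<Rightarrow> real mat" where
  "tensor_gram I J K T = mat (J * K) (J * K)
     (\<lambda>(p,q). \<Sum>i<I. T i (p mod J) (p div J) * T i (q mod J) (q div J))"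

definition matricize :: "nat \<Rightarrow> nat \<Rightarrow> real vec \<Rightarrow> real mat" where
  "matricize J K v = mat J K (\<lambda>(j,k). v $ (j + k * J))"

definition outer :: "real vec \<Rightarrow> real vec \<Rightarrow> real mat" where
  "outer b c = mat (dim_vec b) (dim_vec c) (\<lambda>(j,k). b $ j * c $ k)"

text \<open>The linear combinations of the \<open>outer (col B r) (col C r)\<close>, written entrywise.\<close>

definition khatri_rao_range :: "real mat \<Rightarrow> real mat \<Rightarrow> real mat set" where
  "khatri_rao_range B C =
     {mat (dim_row B) (dim_row C)
        (\<lambda>(j,k). \<Sum>r<dim_col B. \<mu> r * outer (col B r) (col C r) $$ (j,k)) | \<mu> :: nat \<Rightarrow> real. True}"

definition frobenius_norm :: "real mat \<Rightarrow> real" where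
  "frobenius_norm X = sqrt (\<Sum>j<dim_row X. \<Sum>k<dim_col X. (X $$ (j,k))\<^sup>2)"

definition frobenius_dist :: "real mat \<Rightarrow> real mat set \<Rightarrow> real" where
  "frobenius_dist X S = (INF Y\<in>S. frobenius_norm (X - Y))"

end

theory Submission
  imports Defs
begin

text \<open>
  Flatten the pair \<open>(j, k)\<close> to the position \<open>p = j + k * J\<close> and let \<open>w\<^sub>r\<close> be the flattened
  \<open>r\<close>-th rank-one matrix, the outer product of the \<open>r\<close>-th columns of \<open>B\<close> and \<open>C\<close>. The objective
  is half the sum over the slices \<open>t\<^sub>i\<close> of the tensor of
  \<open>\<parallel>t\<^sub>i - (\<Sum>r<R. a\<^sub>i\<^sub>r w\<^sub>r)\<parallel>\<^sup>2\<close>, so the rows of \<open>A\<close> can be optimised independently and the reduced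
  objective is half the sum of the squared distances of the \<open>t\<^sub>i\<close> to the span of the \<open>w\<^sub>r\<close>.
  The minimum is attained wherever the normal equations hold, and these always have a solution,
  even if the \<open>w\<^sub>r\<close> are linearly dependent.

  The squared distance to a fixed subspace is a quadratic form \<open>x \<mapsto> \<Sum>p q. x p * Q p q * x q\<close>,
  where \<open>Q\<close> is the projection onto the orthogonal complement (lemma
  \<open>residual_quadratic_form\<close>). Such a form, summed over a family of vectors, depends only on the
  Gram matrix \<open>M p q = \<Sum>i. t\<^sub>i p * t\<^sub>i q\<close>, through \<open>\<Sum>p q. Q p q * M p q\<close>. As \<open>M\<close> is also
  \<open>\<Sum>m. l\<^sub>m * v\<^sub>m p * v\<^sub>m q\<close>, the same sum is the \<open>l\<close>-weighted sum of the squared distances of the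
  columns \<open>v\<^sub>m\<close> of \<open>V\<close>. Flattening preserves the Frobenius norm, so these are the distances of
  the matricized \<open>v\<^sub>m\<close> to the Khatri-Rao range.
\<close>

section \<open>Least squares through the normal equations\<close>

text \<open>Vectors are real functions, of which only the values on the index set \<open>S\<close> matter.
  \<open>residual n w x c\<close> is the difference of \<open>x\<close> and the combination of \<open>w 0, \<dots>, w (n - 1)\<close> with
  coefficients \<open>c\<close>.\<close>

definition residual :: "nat \<Rightarrow> (nat \<Rightarrow> 'a \<Rightarrow> real) \<Rightarrow> ('a \<Rightarrow> real) \<Rightarrow> (nat \<Rightarrow> real) \<Rightarrow> 'a \<Rightarrow> real" where
  "residual n w x c p = x p - (\<Sum>r<n. c r * w r p)"

text \<open>The normal equations of the least squares problem for \<open>x\<close>: the residual is orthogonal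
  to every \<open>w r\<close>.\<close>

definition normal_eqs ::
  "'a set \<Rightarrow> nat \<Rightarrow> (nat \<Rightarrow> 'a \<Rightarrow> real) \<Rightarrow> ('a \<Rightarrow> real) \<Rightarrow> (nat \<Rightarrow> real) \<Rightarrow> bool" where
  "normal_eqs S n w x c \<longleftrightarrow> (\<forall>r<n. (\<Sum>p\<in>S. residual n w x c p * w r p) = 0)"

lemma residual_orthogonal_comb:
  assumes "normal_eqs S n w x c"
  shows "(\<Sum>p\<in>S. residual n w x c p * (\<Sum>r<n. d r * w r p)) = 0"
proof -
  have "(\<Sum>p\<in>S. residual n w x c p * (\<Sum>r<n. d r * w r p))
      = (\<Sum>p\<in>S. \<Sum>r<n. d r * (residual n w x c p * w r p))"
    by (simp add: sum_distrib_left mult.left_commute)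
  also have "\<dots> = (\<Sum>r<n. d r * (\<Sum>p\<in>S. residual n w x c p * w r p))"
    by (subst sum.swap) (simp add: sum_distrib_left)
  also have "\<dots> = 0"
    using assms by (simp add: normal_eqs_def)
  finally show ?thesis .
qed

lemma residual_sq_minimal:
  assumes "normal_eqs S n w x c"
  shows "(\<Sum>p\<in>S. (residual n w x c p)\<^sup>2) \<le> (\<Sum>p\<in>S. (residual n w x d p)\<^sup>2)"
proof -
  let ?u = "\<lambda>p. \<Sum>r<n. (c r - d r) * w r p"
  have "residual n w x d p = residual n w x c p + ?u p" for p
    by (simp add: residual_def left_diff_distrib sum_subtractf)
  then have "(\<Sum>p\<in>S. (residual n w x d p)\<^sup>2)
      = (\<Sum>p\<in>S. (residual n w x c p)\<^sup>2) + 2 * (\<Sum>p\<in>S. residual n w x c p * ?u p) + (\<Sum>p\<in>S. (?u p)\<^sup>2)"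
    by (simp add: power2_sum sum.distrib sum_distrib_left mult.assoc)
  also have "(\<Sum>p\<in>S. residual n w x c p * ?u p) = 0"
    using assms by (rule residual_orthogonal_comb)
  finally show ?thesis
    by (simp add: sum_nonneg)
qed

text \<open>One Gram-Schmidt step per vector: \<open>w n\<close> is replaced by its residual \<open>u\<close> against the
  earlier vectors, and the component of \<open>x\<close> along \<open>u\<close> is removed.\<close>

lemma normal_eqs_solvable:
  assumes "finite S"
  shows "\<exists>c. normal_eqs S n w x c"
proof (induction n arbitrary: x)
  case 0
  show ?case by (simp add: normal_eqs_def)
next
  case (Suc n)
  obtain c where c: "normal_eqs S n w x c" using Suc by blast
  obtain d where d: "normal_eqs S n w (w n) d" using Suc by blast
  define y where "y = residual n w x c"
  define u where "u = residual n w (w n) d"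
  \<comment> \<open>If \<open>w n\<close> depends on the earlier vectors, then \<open>u = 0\<close> on \<open>S\<close> and \<open>t = 0\<close> by the convention
    for division by zero, so \<open>c\<close> is kept.\<close>
  define t where "t = (\<Sum>p\<in>S. y p * u p) / (\<Sum>p\<in>S. u p * u p)"
  define e where "e r = (if r = n then t else c r - t * d r)" for r
  have e: "residual (Suc n) w x e p = y p - t * u p" for p
    by (simp add: residual_def y_def u_def e_def algebra_simps sum_subtractf sum_distrib_left)
  have early: "(\<Sum>p\<in>S. (y p - t * u p) * w r p) = 0" if "r < n" for r
    using c d that
    by (simp add: normal_eqs_def y_def u_def left_diff_distrib sum_subtractf mult.assoc
        flip: sum_distrib_left)
  have "(\<Sum>p\<in>S. (y p - t * u p) * u p) = 0"
  proof (cases "(\<Sum>p\<in>S. u p * u p) = 0")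
    case True
    then have "\<forall>p\<in>S. u p = 0"
      using assms by (subst (asm) sum_nonneg_eq_0_iff) auto
    then show ?thesis by simp
  next
    case False
    have "(\<Sum>p\<in>S. (y p - t * u p) * u p) = (\<Sum>p\<in>S. y p * u p) - t * (\<Sum>p\<in>S. u p * u p)"
      by (simp add: left_diff_distrib sum_subtractf mult.assoc flip: sum_distrib_left)
    with False show ?thesis by (simp add: t_def)
  qed
  moreover have "(\<Sum>p\<in>S. (y p - t * u p) * (\<Sum>r<n. d r * w r p)) = 0"
  proof -
    have "(\<Sum>p\<in>S. (y p - t * u p) * (\<Sum>r<n. d r * w r p))
        = (\<Sum>p\<in>S. y p * (\<Sum>r<n. d r * w r p)) - t * (\<Sum>p\<in>S. u p * (\<Sum>r<n. d r * w r p))"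
      by (simp add: left_diff_distrib sum_subtractf mult.assoc flip: sum_distrib_left)
    then show ?thesis
      using residual_orthogonal_comb[OF c] residual_orthogonal_comb[OF d]
      by (simp add: y_def u_def)
  qed
  moreover have "w n p = u p + (\<Sum>r<n. d r * w r p)" for p
    by (simp add: u_def residual_def)
  ultimately have "(\<Sum>p\<in>S. (y p - t * u p) * w n p) = 0"
    by (simp add: distrib_left sum.distrib)
  with early have "normal_eqs S (Suc n) w x e"
    by (simp add: normal_eqs_def e less_Suc_eq)
  then show ?case by blast
qed

text \<open>The coefficients can be chosen linear in \<open>x\<close>, by superposing solutions for the unit
  vectors; this makes the least squared distance a quadratic form in \<open>x\<close> whose matrix \<open>Q\<close> does
  not depend on \<open>x\<close>.\<close>

lemma residual_quadratic_form:
  assumes "finite S"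
  obtains Q where "\<And>x. \<exists>c. normal_eqs S n w x c \<and>
    (\<Sum>p\<in>S. (residual n w x c p)\<^sup>2) = (\<Sum>p\<in>S. \<Sum>q\<in>S. Q p q * (x p * x q))"
proof -
  define unit :: "'a \<Rightarrow> 'a \<Rightarrow> real" where "unit q p = (if p = q then 1 else 0)" for q p
  have "\<forall>q. \<exists>c. normal_eqs S n w (unit q) c"
    using normal_eqs_solvable[OF assms] by blast
  then obtain L where L: "\<And>q. normal_eqs S n w (unit q) (L q)"
    by metis
  define Q where "Q p q = residual n w (unit q) (L q) p" for p q
  show thesis
  proof (rule that)
    fix x
    define c where "c r = (\<Sum>q\<in>S. x q * L q r)" for r
    have res: "residual n w x c p = (\<Sum>q\<in>S. Q p q * x q)" if "p \<in> S" for p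
    proof -
      have "(\<Sum>q\<in>S. Q p q * x q)
          = (\<Sum>q\<in>S. unit q p * x q) - (\<Sum>q\<in>S. \<Sum>r<n. x q * L q r * w r p)"
        by (simp add: Q_def residual_def right_diff_distrib sum_subtractf sum_distrib_left
            mult_ac)
      also have "(\<Sum>q\<in>S. unit q p * x q) = (\<Sum>q\<in>S. if p = q then x q else 0)"
        by (rule sum.cong) (simp_all add: unit_def)
      also have "\<dots> = x p"
        using that assms by simp
      also have "(\<Sum>q\<in>S. \<Sum>r<n. x q * L q r * w r p) = (\<Sum>r<n. c r * w r p)"
        by (subst sum.swap) (simp add: c_def sum_distrib_right)
      finally show ?thesis by (simp add: residual_def)
    qed
    have normal: "normal_eqs S n w x c"
      unfolding normal_eqs_def
    proof (intro allI impI)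
      fix r assume r: "r < n"
      have "(\<Sum>p\<in>S. residual n w x c p * w r p) = (\<Sum>p\<in>S. \<Sum>q\<in>S. x q * (Q p q * w r p))"
        by (simp add: res sum_distrib_right sum_distrib_left mult_ac)
      also have "\<dots> = (\<Sum>q\<in>S. x q * (\<Sum>p\<in>S. Q p q * w r p))"
        by (subst sum.swap) (simp add: sum_distrib_left)
      also have "\<dots> = 0"
        using L r by (simp add: normal_eqs_def Q_def)
      finally show "(\<Sum>p\<in>S. residual n w x c p * w r p) = 0" .
    qed
    \<comment> \<open>The residual is orthogonal to the combination that is subtracted from \<open>x\<close>, so one factor
      of its square may be replaced by \<open>x\<close>.\<close>
    have "(\<Sum>p\<in>S. (residual n w x c p)\<^sup>2)
        = (\<Sum>p\<in>S. residual n w x c p * x p)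
          - (\<Sum>p\<in>S. residual n w x c p * (\<Sum>r<n. c r * w r p))"
      unfolding sum_subtractf[symmetric]
      by (rule sum.cong) (simp_all add: residual_def power2_eq_square algebra_simps)
    also have "\<dots> = (\<Sum>p\<in>S. residual n w x c p * x p)"
      using residual_orthogonal_comb[OF normal] by simp
    also have "\<dots> = (\<Sum>p\<in>S. \<Sum>q\<in>S. Q p q * (x p * x q))"
      by (simp add: res sum_distrib_left sum_distrib_right mult_ac)
    finally show "\<exists>c. normal_eqs S n w x c \<and>
        (\<Sum>p\<in>S. (residual n w x c p)\<^sup>2) = (\<Sum>p\<in>S. \<Sum>q\<in>S. Q p q * (x p * x q))"
      using normal by blast
  qed
qed

section \<open>Flattening of index pairs\<close>

lemma sum_grid_flatten:
  fixes g :: "nat \<Rightarrow> nat \<Rightarrow> 'a::comm_monoid_add"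
  shows "(\<Sum>j<J. \<Sum>k<K. g j k) = (\<Sum>p<J * K. g (p mod J) (p div J))"
proof -
  have lt: "j + k * J < J * K" if "j < J" "k < K" for j k
  proof -
    have "j + k * J < Suc k * J" using that by simp
    also have "\<dots> \<le> K * J" using that by (intro mult_le_mono1) simp
    finally show ?thesis by (simp add: mult.commute)
  qed
  have "(\<Sum>j<J. \<Sum>k<K. g j k) = (\<Sum>(j,k)\<in>{..<J} \<times> {..<K}. g j k)"
    by (simp add: sum.cartesian_product)
  also have "\<dots> = (\<Sum>p<J * K. g (p mod J) (p div J))"
    by (rule sum.reindex_bij_witness[where i = "\<lambda>p. (p mod J, p div J)" and j = "\<lambda>(j, k). j + k * J"])
      (auto simp: lt less_mult_imp_div_less mult.commute intro!: mod_less_divisor gr0I)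
  finally show ?thesis .
qed

text \<open>The flattened outer product of the \<open>r\<close>-th columns of \<open>B\<close> and \<open>C\<close>.\<close>

definition rank_one_flat :: "nat \<Rightarrow> real mat \<Rightarrow> real mat \<Rightarrow> nat \<Rightarrow> nat \<Rightarrow> real" where
  "rank_one_flat J B C r p = B $$ (p mod J, r) * C $$ (p div J, r)"

lemma cp_objective_eq_residual:
  "cp_objective I J K R T A B C = 1/2 * (\<Sum>i<I. \<Sum>p<J * K.
     (residual R (rank_one_flat J B C) (\<lambda>p. T i (p mod J) (p div J)) (\<lambda>r. A $$ (i, r)) p)\<^sup>2)"
  by (simp add: cp_objective_def sum_grid_flatten residual_def rank_one_flat_def mult.assoc)

lemma cp_reduced_objective_eq:
  assumes "\<And>i. normal_eqs {..<J * K} R (rank_one_flat J B C) (\<lambda>p. T i (p mod J) (p div J)) (c i)"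
  shows "cp_reduced_objective I J K R T B C = 1/2 * (\<Sum>i<I. \<Sum>p<J * K.
     (residual R (rank_one_flat J B C) (\<lambda>p. T i (p mod J) (p div J)) (c i) p)\<^sup>2)"
    (is "_ = ?m")
  unfolding cp_reduced_objective_def
proof (rule Least_equality)
  let ?A = "mat I R (\<lambda>(i, r). c i r)"
  have "cp_objective I J K R T ?A B C = ?m"
    unfolding cp_objective_eq_residual by (simp add: residual_def)
  then show "\<exists>A\<in>carrier_mat I R. ?m = cp_objective I J K R T A B C"
    by (intro bexI[of _ ?A]) simp_all
next
  fix y assume "\<exists>A\<in>carrier_mat I R. y = cp_objective I J K R T A B C"
  then show "?m \<le> y"
    unfolding cp_objective_eq_residual
    by (auto intro!: sum_mono residual_sq_minimal assms)
qed

lemma frobenius_dist_khatri_rao_range_sq: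
  assumes B: "B \<in> carrier_mat J R" and C: "C \<in> carrier_mat K R"
    and normal: "normal_eqs {..<J * K} R (rank_one_flat J B C) (\<lambda>p. v $ p) c"
  shows "(frobenius_dist (matricize J K v) (khatri_rao_range B C))\<^sup>2
    = (\<Sum>p<J * K. (residual R (rank_one_flat J B C) (\<lambda>p. v $ p) c p)\<^sup>2)"
proof -
  define Y where "Y \<mu> = mat (dim_row B) (dim_row C)
      (\<lambda>(j,k). \<Sum>r<dim_col B. \<mu> r * outer (col B r) (col C r) $$ (j,k))" for \<mu> :: "nat \<Rightarrow> real"
  define N where
    "N \<mu> = sqrt (\<Sum>p<J * K. (residual R (rank_one_flat J B C) (\<lambda>p. v $ p) \<mu> p)\<^sup>2)" for \<mu>
  have norm: "frobenius_norm (matricize J K v - Y \<mu>) = N \<mu>" for \<mu>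
  proof -
    have "frobenius_norm (matricize J K v - Y \<mu>)
        = sqrt (\<Sum>j<J. \<Sum>k<K. (v $ (j + k * J) - (\<Sum>r<R. \<mu> r * (B $$ (j, r) * C $$ (k, r))))\<^sup>2)"
      using B C by (simp add: frobenius_norm_def matricize_def Y_def outer_def)
    then show ?thesis
      by (simp add: sum_grid_flatten N_def residual_def rank_one_flat_def)
  qed
  have "khatri_rao_range B C = range Y"
    by (auto simp: khatri_rao_range_def Y_def)
  then have "frobenius_dist (matricize J K v) (khatri_rao_range B C) = Inf (range N)"
    by (simp add: frobenius_dist_def image_image norm)
  also have "\<dots> = N c"
    by (rule cInf_eq_minimum) (auto simp: N_def residual_sq_minimal[OF normal])
  finally show ?thesis
    by (simp add: N_def sum_nonneg)
qed

section \<open>The two expressions of the Gram matrix\<close>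

lemma spectral_entry:
  fixes V :: "real mat"
  assumes V: "V \<in> carrier_mat n n" and "p < n" "q < n"
  shows "(V * mat_diag n l * transpose_mat V) $$ (p, q) = (\<Sum>m<n. l m * (V $$ (p, m) * V $$ (q, m)))"
proof -
  have "V * mat_diag n l = mat n n (\<lambda>(i, j). V $$ (i, j) * l j)"
    using mat_diag_mult_right[OF V] .
  then show ?thesis
    using assms by (auto simp: scalar_prod_def atLeast0LessThan mult_ac intro!: sum.cong)
qed

lemma sum_quadratic_form:
  fixes Q :: "'a \<Rightarrow> 'a \<Rightarrow> real"
  shows "(\<Sum>m\<in>F. l m * (\<Sum>p\<in>S. \<Sum>q\<in>S. Q p q * (x m p * x m q)))
    = (\<Sum>p\<in>S. \<Sum>q\<in>S. Q p q * (\<Sum>m\<in>F. l m * (x m p * x m q)))"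
proof -
  have "(\<Sum>m\<in>F. l m * (\<Sum>p\<in>S. \<Sum>q\<in>S. Q p q * (x m p * x m q)))
      = (\<Sum>m\<in>F. \<Sum>p\<in>S. \<Sum>q\<in>S. Q p q * (l m * (x m p * x m q)))"
    by (simp add: sum_distrib_left mult.left_commute)
  also have "\<dots> = (\<Sum>p\<in>S. \<Sum>m\<in>F. \<Sum>q\<in>S. Q p q * (l m * (x m p * x m q)))"
    by (rule sum.swap)
  also have "\<dots> = (\<Sum>p\<in>S. \<Sum>q\<in>S. \<Sum>m\<in>F. Q p q * (l m * (x m p * x m q)))"
    by (intro sum.cong refl sum.swap)
  finally show ?thesis
    by (simp add: sum_distrib_left)
qed

section \<open>The reduced objective as a weighted sum of squared distances\<close>

theorem theorem3p14:
  fixes I J K R :: nat and T :: "nat \<Rightarrow> nat \<Rightarrow> nat \<Rightarrow> real"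
    and V :: "real mat" and l :: "nat \<Rightarrow> real" and B C :: "real mat"
  assumes "I \<ge> 1" and "J \<ge> 1" and "K \<ge> 1" and "R \<ge> 1"
    and "V \<in> carrier_mat (J * K) (J * K)"
    and "transpose_mat V * V = 1\<^sub>m (J * K)"
    and "tensor_gram I J K T = V * mat_diag (J * K) l * transpose_mat V"
    and "B \<in> carrier_mat J R" and "C \<in> carrier_mat K R"
  shows "cp_reduced_objective I J K R T B C =
    1/2 * (\<Sum>i<J * K. l i * (frobenius_dist (matricize J K (col V i)) (khatri_rao_range B C))\<^sup>2)"
proof -
  let ?S = "{..<J * K}"
  let ?w = "rank_one_flat J B C"
  let ?t = "\<lambda>i p. T i (p mod J) (p div J)"
  obtain Q where "\<And>x. \<exists>c. normal_eqs ?S R ?w x c \<and>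
      (\<Sum>p\<in>?S. (residual R ?w x c p)\<^sup>2) = (\<Sum>p\<in>?S. \<Sum>q\<in>?S. Q p q * (x p * x q))"
    using residual_quadratic_form[of ?S R ?w] by auto
  then obtain c where normal: "\<And>x. normal_eqs ?S R ?w x (c x)"
    and quad: "\<And>x. (\<Sum>p\<in>?S. (residual R ?w x (c x) p)\<^sup>2) = (\<Sum>p\<in>?S. \<Sum>q\<in>?S. Q p q * (x p * x q))"
    by metis
  have gram: "(\<Sum>i<I. ?t i p * ?t i q) = (\<Sum>m<J * K. l m * (V $$ (p, m) * V $$ (q, m)))"
    if "p \<in> ?S" "q \<in> ?S" for p q
  proof -
    have "(\<Sum>i<I. ?t i p * ?t i q) = tensor_gram I J K T $$ (p, q)"
      using that by (simp add: tensor_gram_def)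
    then show ?thesis
      using that by (simp only: assms(7) spectral_entry[OF assms(5)] lessThan_iff)
  qed
  have dist: "(frobenius_dist (matricize J K (col V m)) (khatri_rao_range B C))\<^sup>2
      = (\<Sum>p\<in>?S. \<Sum>q\<in>?S. Q p q * (V $$ (p, m) * V $$ (q, m)))" if "m < J * K" for m
  proof -
    have "(frobenius_dist (matricize J K (col V m)) (khatri_rao_range B C))\<^sup>2
        = (\<Sum>p\<in>?S. \<Sum>q\<in>?S. Q p q * (col V m $ p * col V m $ q))"
      using frobenius_dist_khatri_rao_range_sq[OF assms(8,9) normal] quad by simp
    then show ?thesis
      using that assms(5) by simp
  qed
  have "cp_reduced_objective I J K R T B C
      = 1/2 * (\<Sum>i<I. \<Sum>p\<in>?S. \<Sum>q\<in>?S. Q p q * (?t i p * ?t i q))"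
    using cp_reduced_objective_eq[where c = "\<lambda>i. c (?t i)", OF normal] quad by simp
  also have "\<dots> = 1/2 * (\<Sum>p\<in>?S. \<Sum>q\<in>?S. Q p q * (\<Sum>i<I. ?t i p * ?t i q))"
    using sum_quadratic_form[where l = "\<lambda>_. 1" and x = ?t and F = "{..<I}" and S = ?S and Q = Q]
    by simp
  also have "\<dots> = 1/2 * (\<Sum>p\<in>?S. \<Sum>q\<in>?S. Q p q * (\<Sum>m<J * K. l m * (V $$ (p, m) * V $$ (q, m))))"
    by (simp add: gram)
  also have "\<dots> = 1/2 * (\<Sum>m<J * K. l m * (\<Sum>p\<in>?S. \<Sum>q\<in>?S. Q p q * (V $$ (p, m) * V $$ (q, m))))"
    using sum_quadratic_form[where l = l and x = "\<lambda>m p. V $$ (p, m)" and F = ?S and S = ?S and Q = Q]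
    by simp
  also have "\<dots> = 1/2 * (\<Sum>m<J * K. l m *
      (frobenius_dist (matricize J K (col V m)) (khatri_rao_range B C))\<^sup>2)"
    by (simp add: dist)
  finally show ?thesis .
qed

end
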